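(* Let $(X,d)$ be a compact metric space and $\mu$ a Borel probability measure on $X$. Let $x_i\in X$, $i\ge1$, be a sequence of independent random draws from $\mu$ and, for each $n\ge1$, let $\mu_n=\frac1n\sum_{i=1}^n\delta_{x_i}$ be the associated empirical measure. Then: (i) $\lim_{n\to\infty}|M_\mu(f)-M_{\mu_n}(f)|=0$ uniformly on $f\in O(X)$, $\otimes_\infty\mu$-almost surely; (ii) $\lim_{n\to\infty}d_H(\Sigma_\mu,\Sigma_{\mu_n})=0$, $\otimes_\infty\mu$-almost surely.
   Context: $\otimes_\infty\mu$ is the product measure of countably many copies of $\mu$ on $X^{\mathbb{N}}$, the space of sequences $(x_i)_{i\ge1}$; $\delta_x$ is the Dirac measure at $x$. $O(X)$ is the set of all 1-Lipschitz functions $f\colon X\to\mathbb{R}$, with the metric induced by $\|f\|_\infty=\sup_{x\in X}|f(x)|$; $O(X)\times O(X)$ carries the metric induced by $\|(f,g)\|_\infty=\max\{\|f\|_\infty,\|g\|_\infty\}$. For a Borel probability measure $\nu$ on $X$: $M_\nu(f)=\int_X f\,d\nu$; $O^c_\nu=\{f\in O(X):M_\nu(f)=0\}$; and the observable covariance is $\Sigma_\nu\colon O^c_\nu\times O^c_\nu\to\mathbb{R}$, $\Sigma_\nu(f,g)=\int_X f(x)g(x)\,d\nu(x)$. Functional Hausdorff distance: let $(Z,d_Z)$ be a metric space and $\phi\colon A\to\mathbb{R}$, $\psi\colon B\to\mathbb{R}$ continuous functions on compact subspaces $A,B\subseteq Z$. A real number $\epsilon>0$ is admissible for $(\phi,\psi)$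 if (a) for any $a\in A$ there is $b\in B$ with $d_Z(a,b)<\epsilon$ and $|\phi(a)-\psi(b)|<\epsilon$; and (b) for any $b\in B$ there is $a\in A$ with $d_Z(a,b)<\epsilon$ and $|\phi(a)-\psi(b)|<\epsilon$. Then $d_H(\phi,\psi)=\inf\{\epsilon>0:\epsilon\text{ is admissible for }(\phi,\psi)\}$. Here it is applied with $Z=O(X)\times O(X)$, $A=O^c_\mu\times O^c_\mu$, $B=O^c_{\mu_n}\times O^c_{\mu_n}$. *)

theory Defs
  imports "HOL-Probability.Probability"
begin

text \<open>
  The ambient compact metric space \<open>X\<close> is a type \<open>'a\<close> of class \<open>metric_space\<close> with
  \<open>compact (UNIV :: 'a set)\<close>. Functions on \<open>X\<close> are taken in the library type of bounded continuous
  functions, whose norm is the supremum norm; by \<open>observables_apply_bcontfun\<close> below nothing is lost,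
  as every 1-Lipschitz function on a compact space is bounded.
\<close>

definition observables :: "('a::metric_space \<Rightarrow>\<^sub>C real) set" where
  "observables = {f. 1-lipschitz_on UNIV (apply_bcontfun f)}"

definition obs_pair_dist ::
    "('a::metric_space \<Rightarrow>\<^sub>C real) \<times> ('a \<Rightarrow>\<^sub>C real) \<Rightarrow> ('a \<Rightarrow>\<^sub>C real) \<times> ('a \<Rightarrow>\<^sub>C real) \<Rightarrow> real" where
  \<comment> \<open>not the library's \<open>dist\<close> on pairs, which is Euclidean\<close>
  "obs_pair_dist p q = max (norm (fst p - fst q)) (norm (snd p - snd q))"

definition obs_mean :: "'a::metric_space measure \<Rightarrow> ('a \<Rightarrow>\<^sub>C real) \<Rightarrow> real" where
  "obs_mean \<nu> f = (\<integral>x. f x \<partial>\<nu>)"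

definition centered_observables :: "'a::metric_space measure \<Rightarrow> ('a \<Rightarrow>\<^sub>C real) set" where
  "centered_observables \<nu> = {f \<in> observables. obs_mean \<nu> f = 0}"

definition obs_covariance ::
    "'a::metric_space measure \<Rightarrow> ('a \<Rightarrow>\<^sub>C real) \<times> ('a \<Rightarrow>\<^sub>C real) \<Rightarrow> real" where
  "obs_covariance \<nu> p = (\<integral>x. fst p x * snd p x \<partial>\<nu>)"

text \<open>
  The functional Hausdorff distance, for functions \<open>\<phi>\<close> on \<open>A\<close> and \<open>\<psi>\<close> on \<open>B\<close>, where \<open>A\<close> and \<open>B\<close> are
  subsets of a space with metric \<open>d\<close>. Only the values of \<open>\<phi>\<close> on \<open>A\<close> and of \<open>\<psi>\<close> on \<open>B\<close> matter.
\<close>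

definition fun_hausdorff_admissible ::
    "('z \<Rightarrow> 'z \<Rightarrow> real) \<Rightarrow> 'z set \<Rightarrow> ('z \<Rightarrow> real) \<Rightarrow> 'z set \<Rightarrow> ('z \<Rightarrow> real) \<Rightarrow> real \<Rightarrow> bool" where
  "fun_hausdorff_admissible d A \<phi> B \<psi> \<epsilon> \<longleftrightarrow>
     (\<forall>a\<in>A. \<exists>b\<in>B. d a b < \<epsilon> \<and> \<bar>\<phi> a - \<psi> b\<bar> < \<epsilon>) \<and>
     (\<forall>b\<in>B. \<exists>a\<in>A. d a b < \<epsilon> \<and> \<bar>\<phi> a - \<psi> b\<bar> < \<epsilon>)"

definition fun_hausdorff_dist ::
    "('z \<Rightarrow> 'z \<Rightarrow> real) \<Rightarrow> 'z set \<Rightarrow> ('z \<Rightarrow> real) \<Rightarrow> 'z set \<Rightarrow> ('z \<Rightarrow> real) \<Rightarrow> real" where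
  "fun_hausdorff_dist d A \<phi> B \<psi> = Inf {\<epsilon>. \<epsilon> > 0 \<and> fun_hausdorff_admissible d A \<phi> B \<psi> \<epsilon>}"

definition obs_covariance_dist :: "'a::metric_space measure \<Rightarrow> 'a measure \<Rightarrow> real" where
  "obs_covariance_dist \<mu> \<nu> =
     fun_hausdorff_dist obs_pair_dist
       (centered_observables \<mu> \<times> centered_observables \<mu>) (obs_covariance \<mu>)
       (centered_observables \<nu> \<times> centered_observables \<nu>) (obs_covariance \<nu>)"

text \<open>Points are numbered from 1; for \<open>n = 0\<close> this is the zero measure.\<close>

definition empirical_measure :: "(nat \<Rightarrow> 'a::metric_space) \<Rightarrow> nat \<Rightarrow> 'a measure" where
  "empirical_measure x n =
     measure_of UNIV (sets borel) (\<lambda>A. 1 / of_nat n * (\<Sum>i=1..n. emeasure (return borel (x i)) A))"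

lemma observables_apply_bcontfun:
  assumes "compact (UNIV :: 'a::metric_space set)"
  shows "apply_bcontfun ` observables = {f :: 'a \<Rightarrow> real. 1-lipschitz_on UNIV f}"
proof
  show "apply_bcontfun ` observables \<subseteq> {f :: 'a \<Rightarrow> real. 1-lipschitz_on UNIV f}"
    by (auto simp: observables_def)
  show "{f :: 'a \<Rightarrow> real. 1-lipschitz_on UNIV f} \<subseteq> apply_bcontfun ` observables"
  proof
    fix f :: "'a \<Rightarrow> real" assume "f \<in> {f. 1-lipschitz_on UNIV f}"
    then have f: "1-lipschitz_on UNIV f" by simp
    then have cont: "continuous_on UNIV f" by (rule lipschitz_on_continuous_on)
    then have "bounded (range f)"
      using assms compact_continuous_image compact_imp_bounded by blast
    with cont have "f \<in> bcontfun" by (simp add: bcontfun_def)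
    then have "f = apply_bcontfun (Bcontfun f)" by (simp add: Bcontfun_inverse)
    with f show "f \<in> apply_bcontfun ` observables"
      by (metis (mono_tags, lifting) imageI mem_Collect_eq observables_def)
  qed
qed

lemma Metric_space_obs_pair_dist: "Metric_space UNIV obs_pair_dist"
proof
  fix p q r :: "('a::metric_space \<Rightarrow>\<^sub>C real) \<times> ('a \<Rightarrow>\<^sub>C real)"
  show "0 \<le> obs_pair_dist p q" by (simp add: obs_pair_dist_def le_max_iff_disj)
  show "obs_pair_dist p q = obs_pair_dist q p" by (simp add: obs_pair_dist_def norm_minus_commute)
  have "max (norm a) (norm b) = 0 \<longleftrightarrow> a = 0 \<and> b = 0" for a b :: "'a \<Rightarrow>\<^sub>C real"
    by (metis max.absorb2 max.cobounded1 max.cobounded2 norm_eq_zero norm_ge_zero order_antisym)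
  then show "obs_pair_dist p q = 0 \<longleftrightarrow> p = q"
    by (simp add: obs_pair_dist_def prod_eq_iff)
  have "norm (fst p - fst r) \<le> norm (fst p - fst q) + norm (fst q - fst r)"
    "norm (snd p - snd r) \<le> norm (snd p - snd q) + norm (snd q - snd r)"
    by (metis dist_norm dist_triangle)+
  then show "obs_pair_dist p r \<le> obs_pair_dist p q + obs_pair_dist q r"
    unfolding obs_pair_dist_def by linarith
qed

lemma sets_empirical_measure [simp]: "sets (empirical_measure x n) = sets borel"
  using sets.sets_measure_of_eq[of borel] by (simp add: empirical_measure_def)

lemma space_empirical_measure [simp]: "space (empirical_measure x n) = UNIV"
  using sets_eq_imp_space_eq[OF sets_empirical_measure] by simp

lemma emeasure_empirical_measure:
  assumes "A \<in> sets borel"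
  shows "emeasure (empirical_measure x n) A = 1 / of_nat n * (\<Sum>i=1..n. emeasure (return borel (x i)) A)"
proof (rule emeasure_measure_of[OF empirical_measure_def])
  let ?m = "\<lambda>A. 1 / of_nat n * (\<Sum>i=1..n. emeasure (return borel (x i)) A)"
  show "positive (sets (empirical_measure x n)) ?m"
    by (simp add: positive_def)
  show "countably_additive (sets (empirical_measure x n)) ?m"
  proof (rule countably_additiveI)
    fix F :: "nat \<Rightarrow> 'a set"
    assume F: "range F \<subseteq> sets (empirical_measure x n)" "disjoint_family F"
    have "(\<Sum>k. ?m (F k)) = 1 / of_nat n * (\<Sum>i=1..n. \<Sum>k. emeasure (return borel (x i)) (F k))"
      by (simp add: suminf_sum)
    also have "\<dots> = ?m (\<Union>k. F k)"
      using F by (subst suminf_emeasure) auto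
    finally show "(\<Sum>k. ?m (F k)) = ?m (\<Union>k. F k)" .
  qed
qed (use assms in auto)

lemma prob_space_empirical_measure:
  assumes "n \<ge> 1"
  shows "prob_space (empirical_measure x n)"
proof
  have "(1::ennreal) / of_nat n * of_nat n = 1"
    using assms ennreal_divide_self[of "of_nat n"]
    by (simp add: ennreal_divide_times of_nat_less_top)
  then show "emeasure (empirical_measure x n) (space (empirical_measure x n)) = 1"
    by (simp add: emeasure_empirical_measure)
qed

end

theory Submission
  imports Defs
begin

text \<open>
  The infinite-dimensional family of all 1-Lipschitz functions is reduced to countably many events.
  Cut the compact space into finitely many Borel cells of diameter about \<open>\<epsilon>\<close>. Every 1-Lipschitz
  function is within \<open>\<epsilon>\<close> of a step function on these cells, so, up to a multiple of \<open>\<epsilon>\<close>, the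
  difference between its means under \<open>\<mu>\<close> and under another probability measure depends only on the
  masses of the cells, and on those with the diameter as Lipschitz constant
  (\<open>obs_mean_diff_le_cells\<close>). By the strong law of large numbers (\<open>AE_LIMSEQ_average_PiM\<close>) the
  empirical mass of each cell almost surely converges to its \<open>\<mu>\<close>-mass. Letting \<open>\<epsilon>\<close> run through a
  sequence gives the uniform convergence of the means.

  The convergence of the covariances then holds for every sample for which the means converge
  uniformly. If all means differ by at most \<open>\<delta>\<close>, then subtracting means turns a \<open>\<mu>\<close>-centred pair
  into a \<open>\<nu>\<close>-centred pair at distance at most \<open>\<delta>\<close>. The covariances differ by at most
  \<open>2 D \<delta> + \<delta>\<^sup>2\<close>, where \<open>D\<close> bounds the diameter: up to the factor \<open>2 D\<close> the product of two centred
  1-Lipschitz functions is again 1-Lipschitz, so that its means too are compared by \<open>\<delta>\<close>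
  (\<open>recenter_pair\<close>).
\<close>

section \<open>The strong law of large numbers for empirical measures\<close>

text \<open>
  The strong law of large numbers for bounded variables. Boundedness makes it elementary: by
  Hoeffding's inequality the probability of a deviation of at least \<open>\<epsilon>\<close> decays geometrically in
  \<open>n\<close>, so by Borel--Cantelli almost surely only finitely many such deviations occur; then \<open>\<epsilon>\<close>
  runs through the countable set of all \<open>1 / (k + 1)\<close>.
\<close>

lemma AE_LIMSEQ_average_PiM:
  fixes \<mu> :: "'a measure" and Y :: "'a \<Rightarrow> real"
  assumes "prob_space \<mu>" and Y[measurable]: "Y \<in> borel_measurable \<mu>"
    and bnd: "\<And>u. Y u \<in> {a..b}" and "a < b"
  shows "AE x in (\<Pi>\<^sub>M i\<in>{1::nat..}. \<mu>). (\<lambda>n. (\<Sum>i=1..n. Y (x i)) / real n) \<longlonglongrightarrow> (\<integral>u. Y u \<partial>\<mu>)"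
proof -
  interpret \<mu>: prob_space \<mu> by fact
  define P where "P = (\<Pi>\<^sub>M i\<in>{1::nat..}. \<mu>)"
  define m where "m = (\<integral>u. Y u \<partial>\<mu>)"
  interpret P: prob_space P
    unfolding P_def by (intro prob_space_PiM \<mu>.prob_space_axioms)
  have coord[measurable]: "(\<lambda>x. x i) \<in> measurable P \<mu>" if "i \<ge> 1" for i
    unfolding P_def by (rule measurable_component_singleton) (use that in auto)
  have distr_coord: "distr P \<mu> (\<lambda>x. x i) = \<mu>" if "i \<ge> 1" for i
    unfolding P_def using that by (intro distr_PiM_component) (auto intro: \<mu>.prob_space_axioms)
  \<comment> \<open>The coordinates are independent since their joint law is the product of their laws.\<close>
  have "distr P P (\<lambda>x. restrict x {1..}) = distr P P (\<lambda>x. x)"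
    by (rule distr_cong) (auto simp: P_def space_PiM)
  also have "\<dots> = P"
    by (rule distr_id)
  also have "P = (\<Pi>\<^sub>M i\<in>{1::nat..}. distr P \<mu> (\<lambda>x. x i))"
    by (subst P_def, rule PiM_cong) (auto simp: distr_coord)
  finally have "P.indep_vars (\<lambda>_. \<mu>) (\<lambda>i x. x i) {1::nat..}"
    by (subst P.indep_vars_iff_distr_eq_PiM') (simp_all flip: P_def One_nat_def)
  then have indep: "P.indep_vars (\<lambda>_. borel) (\<lambda>i x. Y (x i)) {1::nat..}"
    by (rule P.indep_vars_compose2) measurable
  have distr_Y: "distr P borel (\<lambda>x. Y (x i)) = distr \<mu> borel Y" if "i \<ge> 1" for i
    using distr_distr[of Y \<mu> borel "\<lambda>x. x i" P] that by (simp add: distr_coord comp_def)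
  have expectation_eq: "P.expectation (\<lambda>x. Y (x 1)) = m"
    using integral_distr[of "\<lambda>x. x 1" P \<mu> Y] unfolding m_def by (simp add: distr_coord)
  have tail: "P.prob {x\<in>space P. \<bar>(\<Sum>i=1..n. Y (x i)) / real n - m\<bar> \<ge> \<epsilon>}
      \<le> 2 * exp (-2 * real n * \<epsilon>\<^sup>2 / (b - a)\<^sup>2)" if "\<epsilon> > 0" "n \<ge> 1" for \<epsilon> n
  proof -
    interpret H: Hoeffding_ineq_iid P "{1..n}" "\<lambda>i x. Y (x i)" "\<lambda>x. Y (x 1)" a b m
    proof unfold_locales
      show "P.indep_vars (\<lambda>_. borel) (\<lambda>i x. Y (x i)) {1..n}"
        by (rule P.indep_vars_subset[OF indep]) auto
      show "m \<equiv> P.expectation (\<lambda>x. Y (x 1))"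
        by (rule eq_reflection, rule expectation_eq[symmetric])
    qed (use bnd in \<open>auto simp: distr_Y\<close>)
    show ?thesis
      using H.Hoeffding_ineq_abs_ge'[of \<epsilon>] that \<open>a < b\<close> by simp
  qed
  have "AE x in P. \<forall>\<^sub>F n in sequentially. \<bar>(\<Sum>i=1..n. Y (x i)) / real n - m\<bar> < \<epsilon>"
    if "\<epsilon> > 0" for \<epsilon>
  proof -
    define B where "B n = {x\<in>space P. \<bar>(\<Sum>i=1..n. Y (x i)) / real n - m\<bar> \<ge> \<epsilon>}" for n
    have "\<epsilon>\<^sup>2 / (b - a)\<^sup>2 > 0"
      using that \<open>a < b\<close> by simp
    have "summable (\<lambda>n. 2 * exp (-2 * \<epsilon>\<^sup>2 / (b - a)\<^sup>2) ^ n)"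
      using \<open>\<epsilon>\<^sup>2 / (b - a)\<^sup>2 > 0\<close> by (intro summable_mult summable_geometric) simp
    then have "summable (\<lambda>n. P.prob (B n))"
    proof (rule summable_comparison_test'[where N=1])
      fix n :: nat assume "n \<ge> 1"
      then show "norm (P.prob (B n)) \<le> 2 * exp (-2 * \<epsilon>\<^sup>2 / (b - a)\<^sup>2) ^ n"
        using tail[OF that, of n] by (simp add: B_def exp_of_nat_mult[symmetric] algebra_simps)
    qed
    moreover have "B n \<in> sets P" for n
      unfolding B_def by measurable
    ultimately have "AE x in P. \<forall>\<^sub>F n in sequentially. x \<in> space P - B n"
      by (intro borel_cantelli_AE1) (auto simp: P.emeasure_eq_measure)
    then show ?thesis
      by (rule AE_mp) (rule AE_I2, auto simp: B_def elim: eventually_mono)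
  qed
  then have "AE x in P. \<forall>k. \<forall>\<^sub>F n in sequentially. \<bar>(\<Sum>i=1..n. Y (x i)) / real n - m\<bar> < 1 / real (Suc k)"
    by (subst AE_all_countable) simp
  then have "AE x in P. (\<lambda>n. (\<Sum>i=1..n. Y (x i)) / real n) \<longlonglongrightarrow> m"
  proof (rule AE_mp, intro AE_I2 impI tendstoI)
    fix x e assume *: "\<forall>k. \<forall>\<^sub>F n in sequentially. \<bar>(\<Sum>i=1..n. Y (x i)) / real n - m\<bar> < 1 / real (Suc k)"
      and "(0::real) < e"
    then obtain k where "1 / real (Suc k) < e" using nat_approx_posE by blast
    from *[rule_format, of k] show "\<forall>\<^sub>F n in sequentially. dist ((\<Sum>i=1..n. Y (x i)) / real n) m < e"
      by eventually_elim (use \<open>1 / real (Suc k) < e\<close> in \<open>simp add: dist_real_def\<close>)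
  qed
  then show ?thesis by (simp only: P_def m_def)
qed

lemma measure_empirical_measure:
  assumes "A \<in> sets borel"
  shows "measure (empirical_measure x n) A = (\<Sum>i=1..n. indicator A (x i)) / real n"
proof (cases "n = 0")
  case True
  with assms show ?thesis by (simp add: measure_def emeasure_empirical_measure)
next
  case False
  have sum_eq: "(\<Sum>i=1..n. indicator A (x i)) = ennreal (\<Sum>i=1..n. indicator A (x i))"
    by (subst sum_ennreal[symmetric]) (auto simp: ennreal_indicator)
  have inv_eq: "1 / of_nat n = ennreal (1 / real n)"
    using False by (simp add: ennreal_of_nat_eq_real_of_nat divide_ennreal flip: ennreal_1)
  have "emeasure (empirical_measure x n) A = 1 / of_nat n * (\<Sum>i=1..n. indicator A (x i))"
    using assms by (simp add: emeasure_empirical_measure)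
  also have "\<dots> = ennreal ((\<Sum>i=1..n. indicator A (x i)) / real n)"
    unfolding sum_eq inv_eq by (subst ennreal_mult[symmetric]) (auto simp: sum_nonneg)
  finally show ?thesis
    by (simp add: measure_def sum_nonneg)
qed

lemma AE_measure_empirical_measure:
  fixes \<mu> :: "'a::metric_space measure"
  assumes "prob_space \<mu>" "sets \<mu> = sets borel" "A \<in> sets borel"
  shows "AE x in (\<Pi>\<^sub>M i\<in>{1::nat..}. \<mu>).
           (\<lambda>n. measure (empirical_measure x n) A) \<longlonglongrightarrow> measure \<mu> A"
proof -
  have "A \<in> sets \<mu>" "space \<mu> = UNIV"
    using assms sets_eq_imp_space_eq[of \<mu> borel] by simp_all
  then have "(\<integral>u. indicator A u \<partial>\<mu>) = measure \<mu> A"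
    by simp
  moreover have "AE x in (\<Pi>\<^sub>M i\<in>{1::nat..}. \<mu>).
      (\<lambda>n. (\<Sum>i=1..n. indicator A (x i)) / real n) \<longlonglongrightarrow> (\<integral>u. indicator A u \<partial>\<mu>)"
    using assms \<open>A \<in> sets \<mu>\<close>
    by (intro AE_LIMSEQ_average_PiM[where a=0 and b=1]) (auto simp: indicator_def)
  ultimately show ?thesis
    using assms(3) by (simp add: measure_empirical_measure)
qed

section \<open>Means of 1-Lipschitz functions\<close>

text \<open>
  Total boundedness in a form suited to integration: the fibres of \<open>r\<close> are a finite Borel
  partition into sets of small diameter, and \<open>r\<close> itself selects the sample point of each cell.
  A finite net gives such an \<open>r\<close> by sending each point to a net point of a ball that contains it;
  adding the balls one at a time keeps \<open>r\<close> measurable.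
\<close>

lemma finite_range_projection:
  fixes \<epsilon> :: real
  assumes "compact (UNIV :: 'a::metric_space set)" "\<epsilon> > 0"
  obtains r :: "'a::metric_space \<Rightarrow> 'a"
  where "r \<in> measurable borel (count_space UNIV)" "finite (range r)" "\<And>x. dist x (r x) < \<epsilon>"
proof -
  have union: "\<exists>r :: 'a \<Rightarrow> 'a. r \<in> measurable borel (count_space UNIV) \<and> finite (range r)
      \<and> (\<forall>x\<in>(\<Union>s\<in>S. ball s \<epsilon>). dist x (r x) < \<epsilon>)" if "finite S" for S
    using that
  proof induction
    case empty
    show ?case by (rule exI[of _ "\<lambda>_. undefined"]) auto
  next
    case (insert s S)
    then obtain r :: "'a \<Rightarrow> 'a" where [measurable]: "r \<in> measurable borel (count_space UNIV)"
      and r: "finite (range r)" "\<forall>x\<in>(\<Union>s\<in>S. ball s \<epsilon>). dist x (r x) < \<epsilon>"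
      by blast
    let ?r = "\<lambda>x. if x \<in> ball s \<epsilon> then s else r x"
    have [measurable]: "ball s \<epsilon> \<in> sets borel" by simp
    have "?r \<in> measurable borel (count_space UNIV)"
      by measurable
    moreover have "finite (range ?r)"
      by (rule finite_subset[of _ "insert s (range r)"]) (use r(1) in auto)
    moreover have "\<forall>x\<in>(\<Union>s\<in>insert s S. ball s \<epsilon>). dist x (?r x) < \<epsilon>"
      using r(2) by (auto simp: dist_commute)
    ultimately show ?case by blast
  qed
  obtain S :: "'a set" where "finite S" "UNIV \<subseteq> (\<Union>s\<in>S. ball s \<epsilon>)"
    using compactE_image[OF assms(1), of UNIV "\<lambda>s. ball s \<epsilon>"] \<open>\<epsilon> > 0\<close>
    by (metis UNIV_I UN_I centre_in_ball open_ball subsetI)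
  with union[of S] that show thesis
    by (metis (no_types, lifting) UNIV_I subsetD)
qed

lemma diff_const_observables:
  assumes "f \<in> observables"
  shows "f - const_bcontfun c \<in> observables"
proof -
  have "1-lipschitz_on UNIV f" using assms by (simp add: observables_def)
  from lipschitz_onD[OF this] show ?thesis
    by (auto simp: observables_def dist_norm intro!: lipschitz_onI)
qed

context
  fixes \<nu> :: "'a::metric_space measure"
  assumes prob: "prob_space \<nu>" and sets: "sets \<nu> = sets borel"
begin

interpretation prob_space \<nu> by (rule prob)

lemma measurable_bcontfun: "apply_bcontfun (f :: 'a \<Rightarrow>\<^sub>C real) \<in> borel_measurable \<nu>"
  using borel_measurable_continuous_onI[of "apply_bcontfun f"] sets
  by (simp cong: measurable_cong_sets)

lemma integrable_bcontfun: "integrable \<nu> (apply_bcontfun (f :: 'a \<Rightarrow>\<^sub>C real))"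
  by (rule integrable_const_bound[of _ "norm f"]) (auto intro: norm_bounded[of f, simplified] measurable_bcontfun)

lemma obs_mean_diff: "obs_mean \<nu> (f - g) = obs_mean \<nu> f - obs_mean \<nu> g"
  by (simp add: obs_mean_def integrable_bcontfun)

lemma obs_mean_const: "obs_mean \<nu> (const_bcontfun c) = c"
  by (simp add: obs_mean_def prob_space)

text \<open>
  Replacing \<open>f\<close> by the step function \<open>f \<circ> r\<close> costs at most \<open>\<epsilon>\<close>, whatever the 1-Lipschitz function
  \<open>f\<close> and the measure are. This independence of \<open>f\<close> is where uniformity comes from.
\<close>

lemma obs_mean_approx_finite_sum:
  assumes r: "r \<in> measurable borel (count_space UNIV)" "finite (range r)" "\<And>x. dist x (r x) < \<epsilon>"
    and f: "f \<in> observables"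
  shows "\<bar>obs_mean \<nu> f - (\<Sum>c\<in>range r. f c * measure \<nu> (r -` {c}))\<bar> \<le> \<epsilon>"
proof -
  have cell: "r -` {c} \<in> sets \<nu>" for c
    using measurable_sets[OF r(1), of "{c}"] by (simp add: sets)
  have "f (r x) = (\<Sum>c\<in>range r. f c * indicator (r -` {c}) x)" for x
    using r(2) by (simp add: indicator_def sum.delta if_distrib cong: if_cong)
  then have step: "(\<lambda>x. f (r x)) = (\<lambda>x. \<Sum>c\<in>range r. f c * indicator (r -` {c}) x)"
    by blast
  have int: "integrable \<nu> (\<lambda>x. f (r x))"
    unfolding step using cell by (intro Bochner_Integration.integrable_sum integrable_mult_right integrable_real_indicator)
      (auto simp: emeasure_eq_measure)
  have "(\<integral>x. f (r x) \<partial>\<nu>) = (\<Sum>c\<in>range r. f c * measure \<nu> (r -` {c}))"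
    unfolding step using cell
    by (subst Bochner_Integration.integral_sum)
      (auto simp: emeasure_eq_measure sets_eq_imp_space_eq[OF sets])
  then have "obs_mean \<nu> f - (\<Sum>c\<in>range r. f c * measure \<nu> (r -` {c})) = (\<integral>x. f x - f (r x) \<partial>\<nu>)"
    by (simp add: obs_mean_def integrable_bcontfun int)
  moreover have "\<bar>\<integral>x. f x - f (r x) \<partial>\<nu>\<bar> \<le> (\<integral>x. \<bar>f x - f (r x)\<bar> \<partial>\<nu>)"
    by (rule integral_abs_bound)
  moreover have "\<bar>f x - f (r x)\<bar> \<le> \<epsilon>" for x
    using f lipschitz_onD[of 1 UNIV f x "r x"] r(3)[of x] by (auto simp: observables_def dist_real_def)
  then have "(\<integral>x. \<bar>f x - f (r x)\<bar> \<partial>\<nu>) \<le> (\<integral>x. \<epsilon> \<partial>\<nu>)"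
    by (intro integral_mono) (auto simp: int integrable_bcontfun)
  moreover have "(\<integral>x. \<epsilon> \<partial>\<nu>) = \<epsilon>"
    by (simp add: prob_space)
  ultimately show ?thesis by linarith
qed

text \<open>
  A centred function is the average of its own differences \<open>f x - f y\<close> over \<open>y\<close>, and those are
  bounded by the diameter.
\<close>

lemma abs_le_of_centered:
  assumes "f \<in> centered_observables \<nu>" and D: "\<And>x y :: 'a. dist x y \<le> D"
  shows "\<bar>f x\<bar> \<le> D"
proof -
  have "f x = (\<integral>y. f x - f y \<partial>\<nu>)"
    using assms(1) by (simp add: centered_observables_def obs_mean_def integrable_bcontfun prob_space)
  also have "\<bar>\<dots>\<bar> \<le> (\<integral>y. \<bar>f x - f y\<bar> \<partial>\<nu>)"
    by (rule integral_abs_bound)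
  also have "\<bar>f x - f y\<bar> \<le> D" for y
    using assms(1) lipschitz_onD[of 1 UNIV f x y] D[of x y]
    by (auto simp: centered_observables_def observables_def dist_real_def)
  then have "(\<integral>y. \<bar>f x - f y\<bar> \<partial>\<nu>) \<le> (\<integral>y. D \<partial>\<nu>)"
    by (intro integral_mono) (auto simp: integrable_bcontfun)
  finally show ?thesis by (simp add: prob_space)
qed

end

text \<open>
  The gap between two means is controlled by the gaps between the masses of finitely many cells,
  with a bound that is the same for all observables. An observable may be large, but subtracting a
  constant leaves the gap unchanged, so it may be assumed to vanish somewhere and hence to be
  bounded by the diameter.
\<close>

lemma obs_mean_diff_le_cells:
  fixes \<mu> \<nu> :: "'a::metric_space measure"
  assumes \<mu>: "prob_space \<mu>" "sets \<mu> = sets borel" and \<nu>: "prob_space \<nu>" "sets \<nu> = sets borel"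
    and D: "\<And>x y :: 'a. dist x y \<le> D"
    and r: "r \<in> measurable borel (count_space UNIV)" "finite (range r)" "\<And>x. dist x (r x) < \<epsilon>"
    and f: "f \<in> observables"
  shows "\<bar>obs_mean \<mu> f - obs_mean \<nu> f\<bar>
    \<le> 2 * \<epsilon> + D * (\<Sum>c\<in>range r. \<bar>measure \<mu> (r -` {c}) - measure \<nu> (r -` {c})\<bar>)"
proof -
  define a :: 'a where "a = undefined"
  define g where "g = f - const_bcontfun (f a)"
  have g: "g \<in> observables"
    unfolding g_def by (rule diff_const_observables[OF f])
  have g_le: "\<bar>g c\<bar> \<le> D" for c
    using f lipschitz_onD[of 1 UNIV f c a] D[of c a]
    by (auto simp: g_def observables_def dist_real_def)
  define s where "s = (\<lambda>\<kappa>. \<Sum>c\<in>range r. g c * measure \<kappa> (r -` {c}))"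
  have "obs_mean \<mu> f - obs_mean \<nu> f = obs_mean \<mu> g - obs_mean \<nu> g"
    unfolding g_def using \<mu> \<nu> by (simp add: obs_mean_diff obs_mean_const)
  moreover have "\<bar>obs_mean \<mu> g - s \<mu>\<bar> \<le> \<epsilon>" "\<bar>obs_mean \<nu> g - s \<nu>\<bar> \<le> \<epsilon>"
    unfolding s_def using obs_mean_approx_finite_sum[OF _ _ r g] \<mu> \<nu> by blast+
  moreover have "\<bar>s \<mu> - s \<nu>\<bar> \<le> D * (\<Sum>c\<in>range r. \<bar>measure \<mu> (r -` {c}) - measure \<nu> (r -` {c})\<bar>)"
  proof -
    have "s \<mu> - s \<nu> = (\<Sum>c\<in>range r. g c * (measure \<mu> (r -` {c}) - measure \<nu> (r -` {c})))"
      by (simp add: s_def sum_subtractf right_diff_distrib)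
    also have "\<bar>\<dots>\<bar> \<le> (\<Sum>c\<in>range r. \<bar>g c * (measure \<mu> (r -` {c}) - measure \<nu> (r -` {c}))\<bar>)"
      by (rule sum_abs)
    also have "\<dots> \<le> (\<Sum>c\<in>range r. D * \<bar>measure \<mu> (r -` {c}) - measure \<nu> (r -` {c})\<bar>)"
      using g_le by (intro sum_mono) (auto simp: abs_mult intro: mult_right_mono)
    finally show ?thesis by (simp add: sum_distrib_left)
  qed
  ultimately show ?thesis by linarith
qed

text \<open>
  Only countably many sets have to be tested, the cells of one partition for each mesh
  \<open>1 / (k + 1)\<close>; this is what allows the exceptional null sets of the law of large numbers to be
  united.
\<close>

lemma uniform_limit_obs_mean:
  fixes \<mu> :: "'a::metric_space measure" and \<nu> :: "nat \<Rightarrow> 'a measure"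
  assumes \<mu>: "prob_space \<mu>" "sets \<mu> = sets borel"
    and \<nu>: "\<forall>\<^sub>F n in sequentially. prob_space (\<nu> n)" "\<And>n. sets (\<nu> n) = sets borel"
    and D: "\<And>x y :: 'a. dist x y \<le> D"
    and r: "\<And>k. r k \<in> measurable borel (count_space UNIV)" "\<And>k. finite (range (r k))"
      "\<And>k x. dist x (r k x) < 1 / real (Suc k)"
    and cells: "\<And>k c. c \<in> range (r k) \<Longrightarrow>
      (\<lambda>n. measure (\<nu> n) (r k -` {c})) \<longlonglongrightarrow> measure \<mu> (r k -` {c})"
  shows "uniform_limit observables (\<lambda>n f. \<bar>obs_mean \<mu> f - obs_mean (\<nu> n) f\<bar>) (\<lambda>f. 0) sequentially"
proof (rule uniform_limitI)
  fix e :: real assume "e > 0"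
  then obtain k where k: "1 / real (Suc k) < e / 4"
    using nat_approx_posE[of "e / 4"] by auto
  let ?T = "\<lambda>n. \<Sum>c\<in>range (r k). \<bar>measure \<mu> (r k -` {c}) - measure (\<nu> n) (r k -` {c})\<bar>"
  have "(\<lambda>n. D * ?T n) \<longlonglongrightarrow> D * (\<Sum>c\<in>range (r k). \<bar>measure \<mu> (r k -` {c}) - measure \<mu> (r k -` {c})\<bar>)"
    by (intro tendsto_intros cells)
  then have "\<forall>\<^sub>F n in sequentially. D * ?T n < e / 2"
    using \<open>e > 0\<close> by (intro order_tendstoD(2)) auto
  with \<nu>(1) show "\<forall>\<^sub>F n in sequentially. \<forall>f\<in>observables. dist \<bar>obs_mean \<mu> f - obs_mean (\<nu> n) f\<bar> 0 < e"
  proof eventually_elim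
    case (elim n)
    show ?case
    proof
      fix f :: "'a \<Rightarrow>\<^sub>C real" assume "f \<in> observables"
      from obs_mean_diff_le_cells[OF \<mu> elim(1) \<nu>(2) D r(1)[of k] r(2,3) this] elim(2) k
      show "dist \<bar>obs_mean \<mu> f - obs_mean (\<nu> n) f\<bar> 0 < e" by simp
    qed
  qed
qed

section \<open>Stability of the observable covariance\<close>

text \<open>
  Subtracting the \<open>\<nu>\<close>-means from a pair centred for \<open>\<mu>\<close> gives a pair centred for \<open>\<nu>\<close>. Since the
  \<open>\<mu>\<close>-means vanish, the pair is moved by at most \<open>\<delta>\<close>, and the product of the two \<open>\<nu>\<close>-means, by
  which the \<open>\<nu>\<close>-covariance differs from the integral of \<open>f g\<close>, is at most \<open>\<delta>\<^sup>2\<close>. For the integral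
  of \<open>f g\<close> itself the bound \<open>\<delta>\<close> can be used again: both factors are bounded by \<open>D\<close>, so
  \<open>f g / (2 D)\<close> is 1-Lipschitz.
\<close>

lemma recenter_pair:
  fixes \<mu> \<nu> :: "'a::metric_space measure"
  assumes compact: "compact (UNIV :: 'a set)"
    and \<mu>: "prob_space \<mu>" "sets \<mu> = sets borel" and \<nu>: "prob_space \<nu>" "sets \<nu> = sets borel"
    and D: "\<And>x y :: 'a. dist x y \<le> D" "D > 0"
    and \<delta>: "\<forall>f\<in>observables. \<bar>obs_mean \<mu> f - obs_mean \<nu> f\<bar> \<le> \<delta>"
    and p: "p \<in> centered_observables \<mu> \<times> centered_observables \<mu>"
  obtains q where "q \<in> centered_observables \<nu> \<times> centered_observables \<nu>"
    "obs_pair_dist p q \<le> \<delta>" "\<bar>obs_covariance \<mu> p - obs_covariance \<nu> q\<bar> \<le> 2 * D * \<delta> + \<delta>\<^sup>2"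
proof -
  interpret \<nu>: prob_space \<nu> by (rule \<nu>(1))
  obtain f g where [simp]: "p = (f, g)" by (cases p)
  have f: "f \<in> centered_observables \<mu>" and g: "g \<in> centered_observables \<mu>"
    using p by auto
  have f_lip: "1-lipschitz_on UNIV f" and g_lip: "1-lipschitz_on UNIV g"
    using f g by (auto simp: centered_observables_def observables_def)
  define m where "m = obs_mean \<nu>"
  define c where "c h = h - const_bcontfun (m h)" for h
  have c: "c h \<in> centered_observables \<nu>" if "h \<in> centered_observables \<mu>" for h
    using that \<nu> by (simp add: c_def m_def centered_observables_def diff_const_observables
        obs_mean_diff obs_mean_const)
  have m_le: "\<bar>m h\<bar> \<le> \<delta>" if "h \<in> centered_observables \<mu>" for h
    using \<delta> that by (auto simp: m_def centered_observables_def)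
  have norm_c: "norm (h - c h) \<le> \<delta>" if "h \<in> centered_observables \<mu>" for h
    using m_le[OF that] by (intro norm_bound) (simp add: c_def)
  have prod_lip: "1-lipschitz_on UNIV (\<lambda>x. f x * g x / (2 * D))"
  proof (rule lipschitz_onI)
    fix x y :: 'a
    have "f x * g x - f y * g y = f x * (g x - g y) + (f x - f y) * g y"
      by (simp add: algebra_simps)
    also have "\<bar>\<dots>\<bar> \<le> \<bar>f x\<bar> * \<bar>g x - g y\<bar> + \<bar>f x - f y\<bar> * \<bar>g y\<bar>"
      by (metis abs_mult abs_triangle_ineq)
    also have "\<dots> \<le> D * dist x y + dist x y * D"
      using abs_le_of_centered[OF \<mu> f D(1)] abs_le_of_centered[OF \<mu> g D(1)] D(2)
        lipschitz_onD[OF f_lip, of x y] lipschitz_onD[OF g_lip, of x y]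
      by (intro add_mono mult_mono) (auto simp: dist_real_def)
    finally show "dist (f x * g x / (2 * D)) (f y * g y / (2 * D)) \<le> 1 * dist x y"
      using D(2) by (simp add: dist_real_def divide_simps flip: diff_divide_distrib) (simp add: algebra_simps)
  qed simp
  then obtain h where h: "h \<in> observables" "\<And>x. h x = f x * g x / (2 * D)"
    using observables_apply_bcontfun[OF compact] by (auto simp: image_iff set_eq_iff fun_eq_iff) metis
  have prod_eq: "(\<lambda>x. f x * g x) = (\<lambda>x. 2 * D * h x)"
    using D(2) by (simp add: h(2) fun_eq_iff)
  have prod_mean: "(\<integral>x. f x * g x \<partial>\<kappa>) = 2 * D * obs_mean \<kappa> h" for \<kappa>
    unfolding prod_eq by (simp add: obs_mean_def)
  have prod_int: "integrable \<nu> (\<lambda>x. f x * g x)"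
    unfolding prod_eq by (intro integrable_mult_right integrable_bcontfun \<nu>)
  have "(\<integral>x. c f x * c g x \<partial>\<nu>) = (\<integral>x. f x * g x - m g * f x - m f * g x + m f * m g \<partial>\<nu>)"
    by (simp add: c_def algebra_simps)
  also have "\<dots> = (\<integral>x. f x * g x \<partial>\<nu>) - m f * m g"
    using integrable_bcontfun[OF \<nu>] by (simp add: prod_int \<nu>.prob_space) (simp add: m_def obs_mean_def)
  finally have "obs_covariance \<mu> (f, g) - obs_covariance \<nu> (c f, c g)
      = 2 * D * (obs_mean \<mu> h - obs_mean \<nu> h) + m f * m g"
    by (simp add: obs_covariance_def prod_mean algebra_simps)
  also have "\<bar>\<dots>\<bar> \<le> 2 * D * \<bar>obs_mean \<mu> h - obs_mean \<nu> h\<bar> + \<bar>m f\<bar> * \<bar>m g\<bar>"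
    using D(2) abs_triangle_ineq[of "2 * D * (obs_mean \<mu> h - obs_mean \<nu> h)" "m f * m g"]
    by (simp add: abs_mult)
  also have "\<dots> \<le> 2 * D * \<delta> + \<delta> * \<delta>"
    using D(2) bspec[OF \<delta> h(1)] m_le[OF f] m_le[OF g] by (intro add_mono mult_mono) auto
  finally show thesis
    using c[OF f] c[OF g] norm_c[OF f] norm_c[OF g]
    by (intro that[of "(c f, c g)"]) (auto simp: obs_pair_dist_def power2_eq_square)
qed

text \<open>
  Any \<open>\<epsilon>\<close> above both errors of the recentring is admissible, because recentring works in both
  directions. The lower bound rests on there being some admissible \<open>\<epsilon>\<close>: the infimum of the empty
  set of reals is an unspecified number.
\<close>

lemma obs_covariance_dist_le:
  fixes \<mu> \<nu> :: "'a::metric_space measure"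
  assumes compact: "compact (UNIV :: 'a set)"
    and \<mu>: "prob_space \<mu>" "sets \<mu> = sets borel" and \<nu>: "prob_space \<nu>" "sets \<nu> = sets borel"
    and D: "\<And>x y :: 'a. dist x y \<le> D" "D > 0"
    and \<delta>: "\<forall>f\<in>observables. \<bar>obs_mean \<mu> f - obs_mean \<nu> f\<bar> \<le> \<delta>"
    and \<epsilon>: "\<delta> < \<epsilon>" "2 * D * \<delta> + \<delta>\<^sup>2 < \<epsilon>"
  shows "0 \<le> obs_covariance_dist \<mu> \<nu>" "obs_covariance_dist \<mu> \<nu> \<le> \<epsilon>"
proof -
  let ?S = "{\<epsilon>. \<epsilon> > 0 \<and> fun_hausdorff_admissible obs_pair_dist
       (centered_observables \<mu> \<times> centered_observables \<mu>) (obs_covariance \<mu>)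
       (centered_observables \<nu> \<times> centered_observables \<nu>) (obs_covariance \<nu>) \<epsilon>}"
  have "0 \<in> (observables :: ('a \<Rightarrow>\<^sub>C real) set)"
    by (auto simp: observables_def intro!: lipschitz_onI)
  then have "0 \<le> \<delta>" using \<delta> by fastforce
  have \<delta>': "\<forall>f\<in>observables. \<bar>obs_mean \<nu> f - obs_mean \<mu> f\<bar> \<le> \<delta>"
    using \<delta> by (simp add: abs_minus_commute)
  have pair_sym: "obs_pair_dist p q = obs_pair_dist q p" for p q :: "('a \<Rightarrow>\<^sub>C real) \<times> ('a \<Rightarrow>\<^sub>C real)"
    by (simp add: obs_pair_dist_def norm_minus_commute)
  have "\<epsilon> \<in> ?S"
    unfolding fun_hausdorff_admissible_def mem_Collect_eq
  proof (intro conjI ballI)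
    fix p assume "p \<in> centered_observables \<mu> \<times> centered_observables \<mu>"
    then obtain q where "q \<in> centered_observables \<nu> \<times> centered_observables \<nu>"
      "obs_pair_dist p q \<le> \<delta>" "\<bar>obs_covariance \<mu> p - obs_covariance \<nu> q\<bar> \<le> 2 * D * \<delta> + \<delta>\<^sup>2"
      by (rule recenter_pair[OF compact \<mu> \<nu> D \<delta>])
    then show "\<exists>q\<in>centered_observables \<nu> \<times> centered_observables \<nu>.
        obs_pair_dist p q < \<epsilon> \<and> \<bar>obs_covariance \<mu> p - obs_covariance \<nu> q\<bar> < \<epsilon>"
      using \<epsilon> by (intro bexI[of _ q]) auto
  next
    fix q assume "q \<in> centered_observables \<nu> \<times> centered_observables \<nu>"
    then obtain p where "p \<in> centered_observables \<mu> \<times> centered_observables \<mu>"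
      "obs_pair_dist q p \<le> \<delta>" "\<bar>obs_covariance \<nu> q - obs_covariance \<mu> p\<bar> \<le> 2 * D * \<delta> + \<delta>\<^sup>2"
      by (rule recenter_pair[OF compact \<nu> \<mu> D \<delta>'])
    then show "\<exists>p\<in>centered_observables \<mu> \<times> centered_observables \<mu>.
        obs_pair_dist p q < \<epsilon> \<and> \<bar>obs_covariance \<mu> p - obs_covariance \<nu> q\<bar> < \<epsilon>"
      using \<epsilon> by (intro bexI[of _ p]) (auto simp: pair_sym[of p q] abs_minus_commute)
  qed (use \<open>0 \<le> \<delta>\<close> \<epsilon> in auto)
  then show "0 \<le> obs_covariance_dist \<mu> \<nu>" "obs_covariance_dist \<mu> \<nu> \<le> \<epsilon>"
    unfolding obs_covariance_dist_def fun_hausdorff_dist_def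
    by (auto intro!: cInf_greatest cInf_lower bdd_belowI[of _ 0])
qed

lemma obs_covariance_dist_tendsto_0:
  fixes \<mu> :: "'a::metric_space measure" and \<nu> :: "nat \<Rightarrow> 'a measure"
  assumes compact: "compact (UNIV :: 'a set)"
    and \<mu>: "prob_space \<mu>" "sets \<mu> = sets borel"
    and \<nu>: "\<forall>\<^sub>F n in sequentially. prob_space (\<nu> n)" "\<And>n. sets (\<nu> n) = sets borel"
    and lim: "uniform_limit observables (\<lambda>n f. \<bar>obs_mean \<mu> f - obs_mean (\<nu> n) f\<bar>) (\<lambda>f. 0) sequentially"
  shows "(\<lambda>n. obs_covariance_dist \<mu> (\<nu> n)) \<longlonglongrightarrow> 0"
proof (rule tendstoI)
  fix e :: real assume "e > 0"
  obtain D0 where D0: "\<And>x y :: 'a. dist x y \<le> D0"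
    using compact_imp_bounded[OF compact] by (auto simp: bounded_two_points)
  \<comment> \<open>The maximum keeps \<open>D\<close> positive on a one-point space.\<close>
  define D where "D = max D0 1"
  have D: "dist x y \<le> D" "D > 0" for x y :: 'a
    using D0[of x y] by (auto simp: D_def)
  have "(\<lambda>\<delta>. max \<delta> (2 * D * \<delta> + \<delta>\<^sup>2)) \<midarrow>0\<rightarrow> max 0 (2 * D * 0 + 0\<^sup>2)"
    by (intro tendsto_intros)
  then have "((\<lambda>\<delta>. max \<delta> (2 * D * \<delta> + \<delta>\<^sup>2)) \<longlongrightarrow> 0) (at_right 0)"
    by (simp add: filterlim_at_split)
  then have "\<forall>\<^sub>F \<delta> in at_right 0. max \<delta> (2 * D * \<delta> + \<delta>\<^sup>2) < e / 2"
    using \<open>e > 0\<close> by (intro order_tendstoD(2)) auto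
  then have "\<forall>\<^sub>F \<delta> in at_right 0. \<delta> > 0 \<and> \<delta> < e / 2 \<and> 2 * D * \<delta> + \<delta>\<^sup>2 < e / 2"
    using eventually_at_right_less[of "0::real"]
    by eventually_elim (simp only: max_less_iff_conj simp_thms)
  from eventually_happens'[OF trivial_limit_at_right_real this]
  obtain \<delta> where \<delta>: "\<delta> > 0" "\<delta> < e / 2" "2 * D * \<delta> + \<delta>\<^sup>2 < e / 2"
    by blast
  from \<nu>(1) uniform_limitD[OF lim \<delta>(1)]
  show "\<forall>\<^sub>F n in sequentially. dist (obs_covariance_dist \<mu> (\<nu> n)) 0 < e"
  proof eventually_elim
    case (elim n)
    then have "\<forall>f\<in>observables. \<bar>obs_mean \<mu> f - obs_mean (\<nu> n) f\<bar> \<le> \<delta>"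
      by force
    from obs_covariance_dist_le[OF compact \<mu> elim(1) \<nu>(2) D this \<delta>(2,3)] \<open>e > 0\<close>
    show ?case by (simp add: dist_real_def)
  qed
qed

section \<open>Convergence along random samples\<close>

theorem corollary5p5:
  fixes \<mu> :: "'a::metric_space measure"
  assumes "compact (UNIV :: 'a set)"
    and "prob_space \<mu>"
    and "sets \<mu> = sets borel"
  shows "(AE x in (\<Pi>\<^sub>M i\<in>{1::nat..}. \<mu>).
            uniform_limit observables
              (\<lambda>n f. \<bar>obs_mean \<mu> f - obs_mean (empirical_measure x n) f\<bar>) (\<lambda>f. 0) sequentially)
       \<and> (AE x in (\<Pi>\<^sub>M i\<in>{1::nat..}. \<mu>).
            (\<lambda>n. obs_covariance_dist \<mu> (empirical_measure x n)) \<longlonglongrightarrow> 0)"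
proof -
  let ?P = "\<Pi>\<^sub>M i\<in>{1::nat..}. \<mu>"
  obtain D where D: "\<And>x y :: 'a. dist x y \<le> D"
    using compact_imp_bounded[OF assms(1)] by (auto simp: bounded_two_points)
  have "\<exists>r :: 'a \<Rightarrow> 'a. r \<in> measurable borel (count_space UNIV) \<and> finite (range r)
      \<and> (\<forall>x. dist x (r x) < 1 / real (Suc k))" for k
    by (rule finite_range_projection[OF assms(1), of "1 / real (Suc k)"]) auto
  then obtain r :: "nat \<Rightarrow> 'a \<Rightarrow> 'a" where r: "\<And>k. r k \<in> measurable borel (count_space UNIV)"
    "\<And>k. finite (range (r k))" "\<And>k x. dist x (r k x) < 1 / real (Suc k)"
    by metis
  have cell: "r k -` {c} \<in> sets borel" for k c
    using measurable_sets[OF r(1), of "{c}"] by simp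
  have prob: "\<forall>\<^sub>F n in sequentially. prob_space (empirical_measure x n)" for x :: "nat \<Rightarrow> 'a"
    using eventually_ge_at_top[of 1] by eventually_elim (rule prob_space_empirical_measure)
  have "AE x in ?P. \<forall>k. \<forall>c\<in>range (r k).
      (\<lambda>n. measure (empirical_measure x n) (r k -` {c})) \<longlonglongrightarrow> measure \<mu> (r k -` {c})"
    unfolding AE_all_countable
    by (intro allI AE_finite_allI r(2) AE_measure_empirical_measure assms cell)
  then have means: "AE x in ?P. uniform_limit observables
      (\<lambda>n f. \<bar>obs_mean \<mu> f - obs_mean (empirical_measure x n) f\<bar>) (\<lambda>f. 0) sequentially"
    by (rule AE_mp)
      (intro AE_I2 impI uniform_limit_obs_mean[OF assms(2,3) prob _ D r], auto)
  then have "AE x in ?P. (\<lambda>n. obs_covariance_dist \<mu> (empirical_measure x n)) \<longlonglongrightarrow> 0"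
    by (rule AE_mp)
      (intro AE_I2 impI obs_covariance_dist_tendsto_0[OF assms prob], auto)
  with means show ?thesis ..
qed

end
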